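(* Let $X$ be a completely regular topological space. The following are equivalent: (1) $X$ is an extremally disconnected $P$-space. (2) $\mathrm{C}(X)=\mathrm{H}_{nf}(X)$. (3) $\mathrm{C}(X)=\mathcal{NL}(X)$. (4) The Riesz space $\mathrm{C}(X)$ is universally complete.
   Context: $\mathrm{C}(X)$ is the Riesz space of continuous real functions on $X$. $X$ is extremally disconnected if the closure of every open set is open; $X$ is a $P$-space if every cozero set $\{x\mid f(x)\ne0\}$, $f\in\mathrm{C}(X)$, is closed (i.e. clopen). $\overline{\mathbb{IR}}$ is the set of nonempty compact intervals $[\underline{a},\overline{a}]$ of $\overline{\mathbb{R}}=[-\infty,+\infty]$, with the Scott topology of reverse inclusion, generated by the sets $\{\boldsymbol{a}\mid\underline{a}>p\}$ and $\{\boldsymbol{a}\mid\overline{a}<q\}$, $p,q\in\mathbb{Q}$. For $f\colon X\to\overline{\mathbb{IR}}$ write $f(x)=[\underline{f}(x),\overline{f}(x)]$; $f$ is continuous iff $\underline{f}$ is lower semicontinuous and $\overline{f}$ is upper semicontinuous. On the set $\mathrm{C}(X,\overline{\mathbb{IR}})$ of continuous functions let $f\sqsubseteq g$ iff $f(x)\supseteq g(x)$ for all $x$. $f\in\mathrm{C}(X,\overline{\mathbb{IR}})$ is Hausdorff continuous if it is maximal for $\sqsubseteq$, and nearly finite if $\{x\mid\underline{f}(x)\in\mathbb{R}\text{ and }\overline{f}(x)\in\mathbb{R}\}$ is dense. $\mathrm{H}_{nf}(X)$ is the set of nearly finite Hausdorff continuous functions. A real function $f$ is identified with $x\mapsto[f(x),f(x)]$,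 so that $\mathrm{C}(X)\subseteq\mathrm{H}_{nf}(X)$. For $u\colon X\to\overline{\mathbb{R}}$ let $\mathrm{I}(u)(x)=\sup_{V}\inf_{y\in V}u(y)$ and $\mathrm{S}(u)(x)=\inf_{V}\sup_{y\in V}u(y)$, $V$ ranging over the neighbourhoods of $x$. $u$ is normal lower semicontinuous if $\mathrm{I}(\mathrm{S}(u))=u$, and nearly finite if $\{x\mid u(x)\in\mathbb{R}\}$ is dense in $X$. $\mathcal{NL}(X)$ is the set of nearly finite normal lower semicontinuous functions $X\to\overline{\mathbb{R}}$; it contains $\mathrm{C}(X)$. A Riesz space is universally complete if it is Dedekind complete (nonempty subsets bounded above have suprema) and laterally complete (every nonempty set of pairwise disjoint positive elements has a supremum). *)

theory Defs
  imports "HOL-Analysis.Analysis" "HOL-Library.Interval"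
begin

text \<open>
  A space is a value \<open>X :: 'a topology\<close> (possibly empty, no separation axiom built in).  A function on
  \<open>X\<close> is represented by a HOL function that is extensional on \<open>topspace X\<close>, so that equality of
  representatives is equality of functions on \<open>X\<close>.
\<close>

section \<open>Topological notions\<close>

definition extremally_disconnected :: "'a topology \<Rightarrow> bool" where
  "extremally_disconnected X \<longleftrightarrow> (\<forall>U. openin X U \<longrightarrow> openin X (X closure_of U))"

definition C_space :: "'a topology \<Rightarrow> ('a \<Rightarrow> real) set" where
  "C_space X = {f \<in> extensional (topspace X). continuous_map X euclideanreal f}"

definition P_space :: "'a topology \<Rightarrow> bool" where
  "P_space X \<longleftrightarrow> (\<forall>f \<in> C_space X. closedin X {x \<in> topspace X. f x \<noteq> 0})"

definition dense_in :: "'a topology \<Rightarrow> 'a set \<Rightarrow> bool" where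
  "dense_in X D \<longleftrightarrow> X closure_of D = topspace X"

section \<open>Interval functions\<close>

text \<open>
  \<^typ>\<open>ereal interval\<close> is the type of nonempty compact intervals of the extended reals.
  The whole space must be listed among the generators: the interval from \<open>-\<infinity>\<close> to \<open>\<infinity>\<close>
  lies in none of the other generators, and \<^const>\<open>topology_generated_by\<close> takes the union of the
  generators as the underlying space.  This is not the type class topology of \<^typ>\<open>ereal interval\<close>.
\<close>

definition scott_topology :: "ereal interval topology" where
  "scott_topology = topology_generated_by
     (insert UNIV
       ({{a. lower a > ereal p} | p. p \<in> \<rat>} \<union> {{a. upper a < ereal q} | q. q \<in> \<rat>}))"

definition C_interval :: "'a topology \<Rightarrow> ('a \<Rightarrow> ereal interval) set" where
  "C_interval X = {f \<in> extensional (topspace X). continuous_map X scott_topology f}"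

definition info_le :: "'a topology \<Rightarrow> ('a \<Rightarrow> ereal interval) \<Rightarrow> ('a \<Rightarrow> ereal interval) \<Rightarrow> bool" where
  "info_le X f g \<longleftrightarrow> (\<forall>x \<in> topspace X. set_of (f x) \<supseteq> set_of (g x))"

definition hausdorff_continuous :: "'a topology \<Rightarrow> ('a \<Rightarrow> ereal interval) \<Rightarrow> bool" where
  "hausdorff_continuous X f \<longleftrightarrow>
     f \<in> C_interval X \<and> (\<forall>g \<in> C_interval X. info_le X f g \<longrightarrow> g = f)"

definition nearly_finite_interval :: "'a topology \<Rightarrow> ('a \<Rightarrow> ereal interval) \<Rightarrow> bool" where
  "nearly_finite_interval X f \<longleftrightarrow>
     dense_in X {x \<in> topspace X. \<bar>lower (f x)\<bar> \<noteq> \<infinity> \<and> \<bar>upper (f x)\<bar> \<noteq> \<infinity>}"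

definition H_nf :: "'a topology \<Rightarrow> ('a \<Rightarrow> ereal interval) set" where
  "H_nf X = {f. hausdorff_continuous X f \<and> nearly_finite_interval X f}"

definition as_interval_fun :: "'a topology \<Rightarrow> ('a \<Rightarrow> real) \<Rightarrow> ('a \<Rightarrow> ereal interval)" where
  "as_interval_fun X f = restrict (\<lambda>x. interval_of (ereal (f x))) (topspace X)"

section \<open>Normal lower semicontinuous functions\<close>

definition nhds_in :: "'a topology \<Rightarrow> 'a \<Rightarrow> 'a set set" where
  "nhds_in X x = {V. V \<subseteq> topspace X \<and> (\<exists>U. openin X U \<and> x \<in> U \<and> U \<subseteq> V)}"

definition lower_env :: "'a topology \<Rightarrow> ('a \<Rightarrow> ereal) \<Rightarrow> 'a \<Rightarrow> ereal" where
  "lower_env X u x = (SUP V \<in> nhds_in X x. INF y \<in> V. u y)"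

definition upper_env :: "'a topology \<Rightarrow> ('a \<Rightarrow> ereal) \<Rightarrow> 'a \<Rightarrow> ereal" where
  "upper_env X u x = (INF V \<in> nhds_in X x. SUP y \<in> V. u y)"

definition normal_lsc :: "'a topology \<Rightarrow> ('a \<Rightarrow> ereal) \<Rightarrow> bool" where
  "normal_lsc X u \<longleftrightarrow> (\<forall>x \<in> topspace X. lower_env X (upper_env X u) x = u x)"

definition nearly_finite :: "'a topology \<Rightarrow> ('a \<Rightarrow> ereal) \<Rightarrow> bool" where
  "nearly_finite X u \<longleftrightarrow> dense_in X {x \<in> topspace X. \<bar>u x\<bar> \<noteq> \<infinity>}"

definition NL :: "'a topology \<Rightarrow> ('a \<Rightarrow> ereal) set" where
  "NL X = {u \<in> extensional (topspace X). normal_lsc X u \<and> nearly_finite X u}"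

definition as_ereal_fun :: "'a topology \<Rightarrow> ('a \<Rightarrow> real) \<Rightarrow> ('a \<Rightarrow> ereal)" where
  "as_ereal_fun X f = restrict (\<lambda>x. ereal (f x)) (topspace X)"

section \<open>Riesz spaces\<close>

record 'v riesz =
  rcarrier :: "'v set"
  rzero :: 'v
  radd :: "'v \<Rightarrow> 'v \<Rightarrow> 'v"
  rscale :: "real \<Rightarrow> 'v \<Rightarrow> 'v"
  rle :: "'v \<Rightarrow> 'v \<Rightarrow> bool"

definition is_upper_bound :: "'v riesz \<Rightarrow> 'v set \<Rightarrow> 'v \<Rightarrow> bool" where
  "is_upper_bound E A u \<longleftrightarrow> u \<in> rcarrier E \<and> (\<forall>a \<in> A. rle E a u)"

definition is_lower_bound :: "'v riesz \<Rightarrow> 'v set \<Rightarrow> 'v \<Rightarrow> bool" where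
  "is_lower_bound E A u \<longleftrightarrow> u \<in> rcarrier E \<and> (\<forall>a \<in> A. rle E u a)"

definition is_supremum :: "'v riesz \<Rightarrow> 'v set \<Rightarrow> 'v \<Rightarrow> bool" where
  "is_supremum E A s \<longleftrightarrow> is_upper_bound E A s \<and> (\<forall>u. is_upper_bound E A u \<longrightarrow> rle E s u)"

definition is_infimum :: "'v riesz \<Rightarrow> 'v set \<Rightarrow> 'v \<Rightarrow> bool" where
  "is_infimum E A s \<longleftrightarrow> is_lower_bound E A s \<and> (\<forall>u. is_lower_bound E A u \<longrightarrow> rle E u s)"

locale riesz_space =
  fixes E :: "'v riesz"
  assumes zero_closed: "rzero E \<in> rcarrier E"
    and add_closed: "\<lbrakk>x \<in> rcarrier E; y \<in> rcarrier E\<rbrakk> \<Longrightarrow> radd E x y \<in> rcarrier E"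
    and scale_closed: "x \<in> rcarrier E \<Longrightarrow> rscale E c x \<in> rcarrier E"
    and add_assoc: "\<lbrakk>x \<in> rcarrier E; y \<in> rcarrier E; z \<in> rcarrier E\<rbrakk>
        \<Longrightarrow> radd E (radd E x y) z = radd E x (radd E y z)"
    and add_commute: "\<lbrakk>x \<in> rcarrier E; y \<in> rcarrier E\<rbrakk> \<Longrightarrow> radd E x y = radd E y x"
    and add_zero: "x \<in> rcarrier E \<Longrightarrow> radd E x (rzero E) = x"
    and add_inverse: "x \<in> rcarrier E \<Longrightarrow> \<exists>y \<in> rcarrier E. radd E x y = rzero E"
    and scale_add_right: "\<lbrakk>x \<in> rcarrier E; y \<in> rcarrier E\<rbrakk>
        \<Longrightarrow> rscale E c (radd E x y) = radd E (rscale E c x) (rscale E c y)"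
    and scale_add_left: "x \<in> rcarrier E
        \<Longrightarrow> rscale E (c + d) x = radd E (rscale E c x) (rscale E d x)"
    and scale_scale: "x \<in> rcarrier E \<Longrightarrow> rscale E c (rscale E d x) = rscale E (c * d) x"
    and scale_one: "x \<in> rcarrier E \<Longrightarrow> rscale E 1 x = x"
    and le_refl: "x \<in> rcarrier E \<Longrightarrow> rle E x x"
    and le_antisym: "\<lbrakk>x \<in> rcarrier E; y \<in> rcarrier E; rle E x y; rle E y x\<rbrakk> \<Longrightarrow> x = y"
    and le_trans: "\<lbrakk>x \<in> rcarrier E; y \<in> rcarrier E; z \<in> rcarrier E; rle E x y; rle E y z\<rbrakk>
        \<Longrightarrow> rle E x z"
    and add_mono: "\<lbrakk>x \<in> rcarrier E; y \<in> rcarrier E; z \<in> rcarrier E; rle E x y\<rbrakk>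
        \<Longrightarrow> rle E (radd E x z) (radd E y z)"
    and scale_nonneg: "\<lbrakk>x \<in> rcarrier E; rle E (rzero E) x; 0 \<le> c\<rbrakk>
        \<Longrightarrow> rle E (rzero E) (rscale E c x)"
    and sup_exists: "\<lbrakk>x \<in> rcarrier E; y \<in> rcarrier E\<rbrakk> \<Longrightarrow> \<exists>s. is_supremum E {x, y} s"
    and inf_exists: "\<lbrakk>x \<in> rcarrier E; y \<in> rcarrier E\<rbrakk> \<Longrightarrow> \<exists>s. is_infimum E {x, y} s"

definition dedekind_complete :: "'v riesz \<Rightarrow> bool" where
  "dedekind_complete E \<longleftrightarrow>
     (\<forall>A \<subseteq> rcarrier E. A \<noteq> {} \<longrightarrow> (\<exists>u. is_upper_bound E A u) \<longrightarrow> (\<exists>s. is_supremum E A s))"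

text \<open>
  Positive elements are those \<open>\<ge> 0\<close>; since \<open>\<bar>u\<bar> = u\<close> for them, two positive elements are
  disjoint when their infimum is \<open>0\<close>.
\<close>

definition laterally_complete :: "'v riesz \<Rightarrow> bool" where
  "laterally_complete E \<longleftrightarrow>
     (\<forall>A \<subseteq> rcarrier E. A \<noteq> {} \<longrightarrow> (\<forall>u \<in> A. rle E (rzero E) u) \<longrightarrow>
        pairwise (\<lambda>u v. is_infimum E {u, v} (rzero E)) A \<longrightarrow> (\<exists>s. is_supremum E A s))"

definition universally_complete :: "'v riesz \<Rightarrow> bool" where
  "universally_complete E \<longleftrightarrow> riesz_space E \<and> dedekind_complete E \<and> laterally_complete E"

definition C_riesz :: "'a topology \<Rightarrow> ('a \<Rightarrow> real) riesz" where
  "C_riesz X =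
     \<lparr>rcarrier = C_space X,
      rzero = restrict (\<lambda>x. 0) (topspace X),
      radd = (\<lambda>f g. restrict (\<lambda>x. f x + g x) (topspace X)),
      rscale = (\<lambda>c f. restrict (\<lambda>x. c * f x) (topspace X)),
      rle = (\<lambda>f g. \<forall>x \<in> topspace X. f x \<le> g x)\<rparr>"

lemma restrict_C_space:
  assumes "continuous_map X euclideanreal f"
  shows "restrict f (topspace X) \<in> C_space X"
proof -
  have "continuous_map X euclideanreal (restrict f (topspace X))"
    using assms by (rule continuous_map_eq) simp
  then show ?thesis by (simp add: C_space_def)
qed

lemma C_space_cont: "f \<in> C_space X \<Longrightarrow> continuous_map X euclideanreal f"
  by (simp add: C_space_def)

lemma C_space_ext: "\<lbrakk>f \<in> C_space X; g \<in> C_space X; \<And>x. x \<in> topspace X \<Longrightarrow> f x = g x\<rbrakk> \<Longrightarrow> f = g"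
  unfolding C_space_def by (auto intro: extensionalityI)

lemma riesz_space_C_riesz: "riesz_space (C_riesz X)"
proof
  fix x y :: "'a \<Rightarrow> real"
  let ?R = "\<lambda>h. restrict h (topspace X)"
  assume "x \<in> rcarrier (C_riesz X)" "y \<in> rcarrier (C_riesz X)"
  then have xy: "x \<in> C_space X" "y \<in> C_space X" by (auto simp: C_riesz_def)
  have "?R (\<lambda>t. max (x t) (y t)) \<in> C_space X" "?R (\<lambda>t. min (x t) (y t)) \<in> C_space X"
    using xy by (auto intro!: restrict_C_space continuous_map_real_max continuous_map_real_min
        dest: C_space_cont)
  then have "is_supremum (C_riesz X) {x, y} (?R (\<lambda>t. max (x t) (y t)))"
    "is_infimum (C_riesz X) {x, y} (?R (\<lambda>t. min (x t) (y t)))"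
    by (auto simp: is_supremum_def is_infimum_def is_upper_bound_def is_lower_bound_def C_riesz_def)
  then show "\<exists>s. is_supremum (C_riesz X) {x, y} s" "\<exists>s. is_infimum (C_riesz X) {x, y} s"
    by blast+
next
  fix x :: "'a \<Rightarrow> real"
  assume "x \<in> rcarrier (C_riesz X)"
  then have x: "x \<in> C_space X" by (simp add: C_riesz_def)
  have "restrict (\<lambda>t. - x t) (topspace X) \<in> C_space X"
    using x by (auto intro!: restrict_C_space continuous_map_minus dest: C_space_cont)
  then show "\<exists>y\<in>rcarrier (C_riesz X). radd (C_riesz X) x y = rzero (C_riesz X)"
    by (intro bexI[of _ "restrict (\<lambda>t. - x t) (topspace X)"])
       (auto simp: C_riesz_def restrict_def)
next
  fix x y :: "'a \<Rightarrow> real"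
  assume "x \<in> rcarrier (C_riesz X)" "y \<in> rcarrier (C_riesz X)"
    "rle (C_riesz X) x y" "rle (C_riesz X) y x"
  then show "x = y" by (auto simp: C_riesz_def intro!: C_space_ext[of x X y] intro: order_antisym)
next
  fix x y :: "'a \<Rightarrow> real" and c :: real
  assume x: "x \<in> rcarrier (C_riesz X)"
  then have c: "continuous_map X euclideanreal x" by (simp add: C_riesz_def C_space_cont)
  show "rscale (C_riesz X) c x \<in> rcarrier (C_riesz X)"
    using restrict_C_space[OF continuous_map_real_mult_left[OF c]] by (simp add: C_riesz_def)
  assume "y \<in> rcarrier (C_riesz X)"
  then have "continuous_map X euclideanreal y" by (simp add: C_riesz_def C_space_cont)
  from restrict_C_space[OF continuous_map_add[OF c this]]
  show "radd (C_riesz X) x y \<in> rcarrier (C_riesz X)" by (simp add: C_riesz_def)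
next
  show "rzero (C_riesz X) \<in> rcarrier (C_riesz X)"
    by (simp add: C_riesz_def restrict_C_space)
next
  fix x y z :: "'a \<Rightarrow> real"
  assume "rle (C_riesz X) x y" "rle (C_riesz X) y z"
  then show "rle (C_riesz X) x z" by (fastforce simp: C_riesz_def)
next
  fix x :: "'a \<Rightarrow> real"
  assume "x \<in> rcarrier (C_riesz X)"
  then have "x \<in> extensional (topspace X)" by (simp add: C_riesz_def C_space_def)
  then show "radd (C_riesz X) x (rzero (C_riesz X)) = x" "rscale (C_riesz X) 1 x = x"
    by (auto simp: C_riesz_def extensional_def fun_eq_iff)
qed (auto simp: C_riesz_def fun_eq_iff algebra_simps)

section \<open>The inclusions of the continuous real functions\<close>

lemma continuous_map_scott_iff:
  "continuous_map X scott_topology f \<longleftrightarrow>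
     (\<forall>p. openin X {x \<in> topspace X. lower (f x) > p}) \<and>
     (\<forall>q. openin X {x \<in> topspace X. upper (f x) < q})" (is "?L \<longleftrightarrow> ?R")
proof
  assume L: ?L
  have preim: "openin X {x \<in> topspace X. f x \<in> U}" if "openin scott_topology U" for U
    using L that by (auto simp: continuous_map_def)
  have gen: "openin scott_topology {a. lower a > ereal r}" "openin scott_topology {a. upper a < ereal r}"
    if "r \<in> \<rat>" for r
    using that unfolding scott_topology_def by (auto intro!: topology_generated_by_Basis)
  have between: "\<exists>r \<in> \<rat>. a < ereal r \<and> ereal r < b" if ab: "a < b" for a b
  proof -
    obtain r where "a < ereal (real_of_rat r)" "ereal (real_of_rat r) < b"
      using ereal_dense3[OF ab] by blast
    then show ?thesis by (intro bexI[of _ "real_of_rat r"]) simp_all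
  qed
  have 1: "openin X {x \<in> topspace X. lower (f x) > p}" for p
  proof -
    have "{x \<in> topspace X. lower (f x) > p} =
        (\<Union>r \<in> {r \<in> \<rat>. p < ereal r}. {x \<in> topspace X. f x \<in> {a. lower a > ereal r}})"
      using between[of p] by (auto intro: less_trans)
    also have "openin X \<dots>"
      using preim[OF gen(1)] by (intro openin_Union) blast
    finally show ?thesis .
  qed
  have 2: "openin X {x \<in> topspace X. upper (f x) < q}" for q
  proof -
    have "{x \<in> topspace X. upper (f x) < q} =
        (\<Union>r \<in> {r \<in> \<rat>. ereal r < q}. {x \<in> topspace X. f x \<in> {a. upper a < ereal r}})"
      using between[of _ q] by (auto intro: less_trans)
    also have "openin X \<dots>"
      using preim[OF gen(2)] by (intro openin_Union) blast
    finally show ?thesis .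
  qed
  show ?R using 1 2 by blast
next
  assume R: ?R
  show ?L
    unfolding scott_topology_def
  proof (rule continuous_on_generated_topo)
    fix U :: "ereal interval set"
    assume "U \<in> insert UNIV
       ({{a. lower a > ereal p} | p. p \<in> \<rat>} \<union> {{a. upper a < ereal q} | q. q \<in> \<rat>})"
    moreover have "f -` V \<inter> topspace X = {x \<in> topspace X. f x \<in> V}" for V by auto
    ultimately show "openin X (f -` U \<inter> topspace X)" using R by (elim insertE UnE) (auto simp del: vimage_Collect_eq)
  qed auto
qed

lemma openin_C_space:
  assumes "f \<in> C_space X"
  shows "openin X {x \<in> topspace X. ereal (f x) > p}" "openin X {x \<in> topspace X. ereal (f x) < p}"
proof -
  have f: "continuous_map X euclideanreal f" using assms by (rule C_space_cont)
  have "continuous_map X euclidean (ereal \<circ> f)"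
    by (rule continuous_map_compose[OF f]) (simp add: continuous_on_ereal)
  from openin_continuous_map_preimage[OF this, of "{p<..}"]
    openin_continuous_map_preimage[OF this, of "{..<p}"]
  show "openin X {x \<in> topspace X. ereal (f x) > p}" "openin X {x \<in> topspace X. ereal (f x) < p}"
    by simp_all
qed

lemma as_interval_fun_in_H_nf:
  assumes f: "f \<in> C_space X"
  shows "as_interval_fun X f \<in> H_nf X"
proof -
  have eq: "{x \<in> topspace X. P (as_interval_fun X f x)} =
      {x \<in> topspace X. P (interval_of (ereal (f x)))}" for P
    by (auto simp: as_interval_fun_def)
  have c: "as_interval_fun X f \<in> C_interval X"
    unfolding C_interval_def mem_Collect_eq continuous_map_scott_iff
    using openin_C_space[OF f] by (simp add: eq[of "\<lambda>a. _ < lower a"] eq[of "\<lambda>a. upper a < _"])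
      (simp add: as_interval_fun_def)
  have "g = as_interval_fun X f"
    if g: "g \<in> C_interval X" and le: "info_le X (as_interval_fun X f) g" for g
  proof (rule extensionalityI[of _ "topspace X"])
    fix x assume x: "x \<in> topspace X"
    then have "set_of (g x) \<subseteq> {ereal (f x)}"
      using le by (auto simp: info_le_def as_interval_fun_def set_of_eq)
    moreover have "lower (g x) \<in> set_of (g x)" "upper (g x) \<in> set_of (g x)"
      by (auto simp: set_of_eq)
    ultimately have "lower (g x) = ereal (f x)" "upper (g x) = ereal (f x)" by blast+
    then show "g x = as_interval_fun X f x"
      using x by (simp add: as_interval_fun_def interval_eq_iff)
  qed (use g c in \<open>auto simp: C_interval_def\<close>)
  moreover have "nearly_finite_interval X (as_interval_fun X f)"
    unfolding nearly_finite_interval_def dense_in_def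
      eq[of "\<lambda>a. \<bar>lower a\<bar> \<noteq> \<infinity> \<and> \<bar>upper a\<bar> \<noteq> \<infinity>"] by simp
  ultimately show ?thesis using c by (auto simp: H_nf_def hausdorff_continuous_def)
qed

lemma as_ereal_fun_in_NL:
  assumes f: "f \<in> C_space X"
  shows "as_ereal_fun X f \<in> NL X"
proof -
  let ?u = "as_ereal_fun X f"
  have u: "?u x = ereal (f x)" if "x \<in> topspace X" for x
    using that by (simp add: as_ereal_fun_def)
  have nb: "{y \<in> topspace X. ereal (f y) > p} \<in> nhds_in X x" if "x \<in> topspace X" "ereal (f x) > p" for x p
    using that openin_C_space(1)[OF f, of p] by (auto simp: nhds_in_def)
  have nb': "{y \<in> topspace X. ereal (f y) < p} \<in> nhds_in X x" if "x \<in> topspace X" "ereal (f x) < p" for x p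
    using that openin_C_space(2)[OF f, of p] by (auto simp: nhds_in_def)
  have S: "upper_env X ?u x = ereal (f x)" if x: "x \<in> topspace X" for x
  proof (rule antisym)
    show "upper_env X ?u x \<le> ereal (f x)"
    proof (rule dense_ge)
      fix p assume "ereal (f x) < p"
      then show "upper_env X ?u x \<le> p"
        unfolding upper_env_def using nb'[OF x]
        by (intro INF_lower2[of "{y \<in> topspace X. ereal (f y) < p}"] SUP_least)
          (auto simp: u)
    qed
    show "ereal (f x) \<le> upper_env X ?u x"
      unfolding upper_env_def using x
      by (intro INF_greatest SUP_upper2[of x]) (auto simp: nhds_in_def u)
  qed
  have "lower_env X (upper_env X ?u) x = ?u x" if x: "x \<in> topspace X" for x
  proof (rule antisym)
    show "?u x \<le> lower_env X (upper_env X ?u) x"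
    proof (rule dense_le)
      fix p assume "p < ?u x"
      then show "p \<le> lower_env X (upper_env X ?u) x"
        unfolding lower_env_def using nb[OF x] x
        by (intro SUP_upper2[of "{y \<in> topspace X. ereal (f y) > p}"] INF_greatest)
          (auto simp: u S)
    qed
    show "lower_env X (upper_env X ?u) x \<le> ?u x"
      unfolding lower_env_def using x
      by (intro SUP_least INF_lower2[of x]) (auto simp: nhds_in_def u S)
  qed
  moreover have "{x \<in> topspace X. \<bar>?u x\<bar> \<noteq> \<infinity>} = topspace X"
    by (auto simp: as_ereal_fun_def)
  ultimately show ?thesis
    by (auto simp: NL_def normal_lsc_def nearly_finite_def dense_in_def as_ereal_fun_def)
qed

end

theory Submission
  imports Defs
begin

text \<open>
  The implications are (1) to (2) to (3) to (4) to (1).  In an extremally disconnected space a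
  Hausdorff continuous interval function is single-valued, and in a P-space the finiteness set of
  a continuous extended real function is a cozero set, hence closed, hence everything when dense.
  A normal lower semicontinuous \<open>u\<close> is the lower bound of the Hausdorff continuous function
  \<open>[u, S u]\<close>.  If all of \<open>NL(X)\<close> is real continuous, the supremum in \<open>C(X)\<close> of a family with
  pointwise supremum \<open>h\<close> is \<open>I (S h)\<close>, as soon as this is nearly finite.  Finally, complete
  regularity makes the closure of an open set \<open>U\<close> the support of the supremum of the continuous
  functions below the indicator of \<open>U\<close>, and lateral completeness rules out a non-closed cozero set.
\<close>

section \<open>Semicontinuity and envelopes\<close>

definition lsc :: "'a topology \<Rightarrow> ('a \<Rightarrow> ereal) \<Rightarrow> bool" where
  "lsc X h \<longleftrightarrow> (\<forall>p. openin X {x \<in> topspace X. p < h x})"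

definition usc :: "'a topology \<Rightarrow> ('a \<Rightarrow> ereal) \<Rightarrow> bool" where
  "usc X h \<longleftrightarrow> (\<forall>p. openin X {x \<in> topspace X. h x < p})"

text \<open>Negation swaps the two notions, and \<open>upper_env_uminus\<close> does the same for
  the envelopes. The main facts about upper envelopes below are the dual ones applied to
  \<open>- u\<close>.\<close>

lemma usc_iff_lsc_uminus: "usc X h \<longleftrightarrow> lsc X (\<lambda>x. - h x)"
proof -
  have "{x \<in> topspace X. p < - h x} = {x \<in> topspace X. h x < - p}" for p
    by (auto simp: ereal_less_uminus_reorder)
  then have "lsc X (\<lambda>x. - h x) \<longleftrightarrow> (\<forall>p. openin X {x \<in> topspace X. h x < - p})"
    by (simp only: lsc_def)
  also have "\<dots> \<longleftrightarrow> usc X h"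
    unfolding usc_def by (metis ereal_uminus_uminus)
  finally show ?thesis by simp
qed

lemma upper_env_uminus: "upper_env X u x = - lower_env X (\<lambda>y. - u y) x"
  by (simp add: upper_env_def lower_env_def ereal_SUP_uminus_eq ereal_INF_uminus_eq)

lemma lower_env_le: "x \<in> topspace X \<Longrightarrow> lower_env X u x \<le> u x"
  unfolding lower_env_def by (intro SUP_least INF_lower2[of x]) (auto simp: nhds_in_def)

lemma lower_env_ge:
  assumes "openin X U" "x \<in> U" "\<And>y. y \<in> U \<Longrightarrow> p \<le> u y"
  shows "p \<le> lower_env X u x"
  unfolding lower_env_def using assms openin_subset[OF assms(1)]
  by (intro SUP_upper2[of U] INF_greatest) (auto simp: nhds_in_def)

lemma lower_env_mono:
  assumes "\<And>y. y \<in> topspace X \<Longrightarrow> u y \<le> v y"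
  shows "lower_env X u x \<le> lower_env X v x"
  unfolding lower_env_def
  by (intro SUP_subset_mono INF_superset_mono order_refl assms) (auto simp: nhds_in_def)

lemma lower_env_cong:
  assumes "\<And>y. y \<in> topspace X \<Longrightarrow> u y = v y"
  shows "lower_env X u x = lower_env X v x"
  using assms by (intro antisym lower_env_mono) auto

lemma lsc_lower_env: "lsc X (lower_env X u)"
  unfolding lsc_def
proof (intro allI, subst openin_subopen, intro ballI)
  fix p x assume "x \<in> {x \<in> topspace X. p < lower_env X u x}"
  then obtain V where V: "V \<in> nhds_in X x" "p < (INF y\<in>V. u y)"
    by (auto simp: lower_env_def less_SUP_iff)
  then obtain U where U: "openin X U" "x \<in> U" "U \<subseteq> V" by (auto simp: nhds_in_def)
  \<comment> \<open>The same open set \<open>U\<close> is a neighbourhood of each of its points, so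
    the bound obtained at \<open>x\<close> holds on all of \<open>U\<close>.\<close>
  have "p < lower_env X u y" if "y \<in> U" for y
    using V(2) U that by (intro less_le_trans[OF _ lower_env_ge[OF U(1)]]) (auto intro: INF_lower)
  with U openin_subset[OF U(1)]
  show "\<exists>T. openin X T \<and> x \<in> T \<and> T \<subseteq> {x \<in> topspace X. p < lower_env X u x}" by blast
qed

text \<open>With \<open>lower_env_le\<close> and \<open>lsc_lower_env\<close> this makes the lower
  envelope the largest lower semicontinuous minorant. The superlevel set of \<open>h\<close> at
  \<open>p\<close> is itself a neighbourhood of \<open>x\<close> witnessing the bound.\<close>

lemma lsc_le_lower_env:
  assumes "lsc X h" "\<And>y. y \<in> topspace X \<Longrightarrow> h y \<le> u y" "x \<in> topspace X"
  shows "h x \<le> lower_env X u x"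
proof (rule dense_le)
  fix p assume "p < h x"
  then show "p \<le> lower_env X u x"
    using assms by (intro lower_env_ge[of X "{y \<in> topspace X. p < h y}"]) (force simp: lsc_def)+
qed

lemma upper_env_ge: "x \<in> topspace X \<Longrightarrow> u x \<le> upper_env X u x"
  using lower_env_le[of x X "\<lambda>y. - u y"]
  by (metis upper_env_uminus ereal_minus_le_minus ereal_uminus_uminus)

lemma upper_env_le:
  assumes "openin X U" "x \<in> U" "\<And>y. y \<in> U \<Longrightarrow> u y \<le> p"
  shows "upper_env X u x \<le> p"
  using lower_env_ge[of X U x "- p" "\<lambda>y. - u y"] assms
  by (simp add: upper_env_uminus ereal_uminus_le_reorder)

lemma upper_env_mono:
  assumes "\<And>y. y \<in> topspace X \<Longrightarrow> u y \<le> v y"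
  shows "upper_env X u x \<le> upper_env X v x"
  unfolding upper_env_uminus using assms by (simp add: lower_env_mono)

lemma upper_env_cong:
  assumes "\<And>y. y \<in> topspace X \<Longrightarrow> u y = v y"
  shows "upper_env X u x = upper_env X v x"
  using assms by (intro antisym upper_env_mono) auto

lemma usc_upper_env: "usc X (upper_env X u)"
  unfolding usc_iff_lsc_uminus upper_env_uminus by (simp add: lsc_lower_env)

lemma upper_env_le_usc:
  assumes "usc X h" "\<And>y. y \<in> topspace X \<Longrightarrow> u y \<le> h y" "x \<in> topspace X"
  shows "upper_env X u x \<le> h x"
  using lsc_le_lower_env[of X "\<lambda>x. - h x" "\<lambda>x. - u x" x] assms
  by (simp add: usc_iff_lsc_uminus upper_env_uminus ereal_uminus_le_reorder)

lemma upper_env_idem: "x \<in> topspace X \<Longrightarrow> upper_env X (upper_env X u) x = upper_env X u x"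
  by (intro antisym upper_env_ge upper_env_le_usc usc_upper_env) auto

text \<open>Write I and S for the envelopes and v for I(S u). Then S v is at most S(S u) = S u,
  hence I(S v) is at most v; conversely v is lower semicontinuous and below S v. This supplies the
  elements of \<open>NL\<close> used to build suprema.\<close>

lemma normal_lsc_lower_upper_env: "normal_lsc X (lower_env X (upper_env X u))"
  unfolding normal_lsc_def
proof (intro ballI antisym)
  fix x assume x: "x \<in> topspace X"
  let ?v = "lower_env X (upper_env X u)"
  have "upper_env X ?v y \<le> upper_env X u y" if "y \<in> topspace X" for y
    using upper_env_mono[of X ?v "upper_env X u" y] that
    by (simp add: lower_env_le upper_env_idem)
  then show "lower_env X (upper_env X ?v) x \<le> ?v x" by (rule lower_env_mono)
  show "?v x \<le> lower_env X (upper_env X ?v) x"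
    using x by (intro lsc_le_lower_env lsc_lower_env upper_env_ge)
qed

lemma normal_lsc_cong:
  assumes "\<And>x. x \<in> topspace X \<Longrightarrow> u x = v x"
  shows "normal_lsc X u \<longleftrightarrow> normal_lsc X v"
  using assms by (simp add: normal_lsc_def upper_env_cong[of X u v] cong: lower_env_cong)

lemma closure_of_meetsE:
  assumes "x \<in> X closure_of S" "openin X T" "x \<in> T"
  obtains y where "y \<in> S" "y \<in> T"
  using assms unfolding in_closure_of by blast

section \<open>Hausdorff continuous functions\<close>

lemma lower_Interval: "a \<le> b \<Longrightarrow> lower (Interval (a, b)) = a"
  by (simp add: lower.rep_eq Interval_inverse)

lemma upper_Interval: "a \<le> b \<Longrightarrow> upper (Interval (a, b)) = b"
  by (simp add: upper.rep_eq Interval_inverse)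

lemma C_interval_iff:
  "f \<in> C_interval X \<longleftrightarrow>
     f \<in> extensional (topspace X) \<and> lsc X (\<lambda>x. lower (f x)) \<and> usc X (\<lambda>x. upper (f x))"
  by (simp add: C_interval_def continuous_map_scott_iff lsc_def usc_def)

lemma lsc_cong:
  assumes "\<And>x. x \<in> topspace X \<Longrightarrow> u x = v x"
  shows "lsc X u \<longleftrightarrow> lsc X v"
  using assms by (simp add: lsc_def cong: conj_cong)

lemma usc_cong:
  assumes "\<And>x. x \<in> topspace X \<Longrightarrow> u x = v x"
  shows "usc X u \<longleftrightarrow> usc X v"
  using assms by (simp add: usc_def cong: conj_cong)

lemma restrict_Interval_in_C_interval:
  assumes "lsc X l" "usc X u" "\<And>x. x \<in> topspace X \<Longrightarrow> l x \<le> u x"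
  shows "(\<lambda>x\<in>topspace X. Interval (l x, u x)) \<in> C_interval X"
  using assms unfolding C_interval_iff
  by (simp add: lower_Interval upper_Interval cong: lsc_cong usc_cong)

lemma info_le_iff:
  "info_le X f g \<longleftrightarrow>
     (\<forall>x \<in> topspace X. lower (f x) \<le> lower (g x) \<and> upper (g x) \<le> upper (f x))"
  by (simp add: info_le_def set_of_eq)

text \<open>Maximality in usable form: to refine \<open>f\<close> it suffices to squeeze a
  semicontinuous pair of bounds between its two ends.\<close>

lemma hausdorff_continuousD:
  assumes f: "hausdorff_continuous X f" and lu: "lsc X l" "usc X u"
    and le: "\<And>x. x \<in> topspace X \<Longrightarrow> lower (f x) \<le> l x \<and> l x \<le> u x \<and> u x \<le> upper (f x)"
    and x: "x \<in> topspace X"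
  shows "lower (f x) = l x" "upper (f x) = u x"
proof -
  let ?g = "\<lambda>x\<in>topspace X. Interval (l x, u x)"
  have "?g \<in> C_interval X" using lu le by (intro restrict_Interval_in_C_interval) auto
  moreover have "info_le X f ?g"
    using le by (simp add: info_le_iff lower_Interval upper_Interval)
  ultimately have "?g = f" using f by (auto simp: hausdorff_continuous_def)
  from fun_cong[OF this, of x] have "f x = Interval (l x, u x)" using x by simp
  then show "lower (f x) = l x" "upper (f x) = u x"
    using le[OF x] by (simp_all add: lower_Interval upper_Interval)
qed

text \<open>The ends of a refinement \<open>g\<close> both lie between u and S u. The lower end is
  lower semicontinuous and below S u, hence below I(S u) = u; the upper end is upper semicontinuous
  and above u, hence above S u. So \<open>g\<close> has the same ends.\<close>

lemma normal_lsc_imp_hausdorff_continuous: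
  assumes u: "normal_lsc X u"
  shows "hausdorff_continuous X (\<lambda>x\<in>topspace X. Interval (u x, upper_env X u x))" (is "hausdorff_continuous _ ?f")
proof -
  have eq: "lower_env X (upper_env X u) x = u x" if "x \<in> topspace X" for x
    using u that by (simp add: normal_lsc_def)
  have lsc: "lsc X u" using lsc_lower_env[of X "upper_env X u"] eq by (simp cong: lsc_cong)
  have f: "?f \<in> C_interval X"
    by (intro restrict_Interval_in_C_interval lsc usc_upper_env upper_env_ge)
  have fx: "lower (?f x) = u x" "upper (?f x) = upper_env X u x" if "x \<in> topspace X" for x
    using that by (simp_all add: lower_Interval upper_Interval upper_env_ge)
  have "g = ?f" if g: "g \<in> C_interval X" and le: "info_le X ?f g" for g
  proof (rule extensionalityI[of _ "topspace X"])
    fix x assume x: "x \<in> topspace X"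
    have 1: "u y \<le> lower (g y)" "upper (g y) \<le> upper_env X u y" if "y \<in> topspace X" for y
      using le that fx by (auto simp: info_le_iff)
    have 2: "u y \<le> upper (g y)" "lower (g y) \<le> upper_env X u y" if "y \<in> topspace X" for y
      using order_trans[OF 1(1)[OF that] lower_le_upper] order_trans[OF lower_le_upper 1(2)[OF that]]
      by simp_all
    have "upper_env X u x \<le> upper (g x)"
      using g x 2 by (intro upper_env_le_usc) (auto simp: C_interval_iff)
    moreover have "lower (g x) \<le> u x"
      using lsc_le_lower_env[of X "\<lambda>x. lower (g x)" "upper_env X u" x] g x 2 eq
      by (auto simp: C_interval_iff)
    ultimately have "lower (g x) = lower (?f x)" "upper (g x) = upper (?f x)"
      using 1[OF x] fx[OF x] by auto
    then show "g x = ?f x" by (rule interval_eqI)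
  qed (use g in \<open>auto simp: C_interval_def\<close>)
  with f show ?thesis by (auto simp: hausdorff_continuous_def)
qed

text \<open>The point is that S u is also finite on a dense set. Where u(x) = r is finite, S u
  cannot be at least r + 1 throughout a neighbourhood of x, since I(S u)(x) = u(x). So points with S
  u < r + 1 occur arbitrarily near x.\<close>

lemma NL_imp_H_nf:
  assumes "u \<in> NL X"
  shows "(\<lambda>x\<in>topspace X. Interval (u x, upper_env X u x)) \<in> H_nf X" (is "?f \<in> _")
proof -
  have u: "normal_lsc X u" and fin: "nearly_finite X u" using assms by (auto simp: NL_def)
  have eq: "lower_env X (upper_env X u) x = u x" if "x \<in> topspace X" for x
    using u that by (simp add: normal_lsc_def)
  have lsc: "lsc X u" using lsc_lower_env[of X "upper_env X u"] eq by (simp cong: lsc_cong)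
  let ?D = "{x \<in> topspace X. \<bar>lower (?f x)\<bar> \<noteq> \<infinity> \<and> \<bar>upper (?f x)\<bar> \<noteq> \<infinity>}"
  have "?D \<inter> T \<noteq> {}" if T: "openin X T" "T \<noteq> {}" for T
  proof -
    have "{x \<in> topspace X. \<bar>u x\<bar> \<noteq> \<infinity>} \<inter> T \<noteq> {}"
      using fin T by (simp add: nearly_finite_def dense_in_def dense_intersects_open)
    then obtain x where "x \<in> {x \<in> topspace X. \<bar>u x\<bar> \<noteq> \<infinity>} \<inter> T" by (meson ex_in_conv)
    then have x: "x \<in> T" "x \<in> topspace X" "\<bar>u x\<bar> \<noteq> \<infinity>" by simp_all
    then obtain r where r: "u x = ereal r" by (cases "u x") simp_all
    \<comment> \<open>Keeping \<open>u\<close> above \<open>r - 1\<close> on \<open>U\<close> makes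
      both ends finite at the point \<open>y\<close> found next.\<close>
    define U where "U = T \<inter> {y \<in> topspace X. ereal (r - 1) < u y}"
    have "openin X {y \<in> topspace X. ereal (r - 1) < u y}" using lsc unfolding lsc_def by blast
    then have U: "openin X U" "x \<in> U"
      unfolding U_def using T x r by (simp_all add: openin_Int)
    have "\<exists>y\<in>U. upper_env X u y < ereal (r + 1)"
    proof (rule ccontr)
      assume "\<not> ?thesis"
      then have "ereal (r + 1) \<le> upper_env X u y" if "y \<in> U" for y
        using that not_le_imp_less by blast
      then have "ereal (r + 1) \<le> lower_env X (upper_env X u) x" by (rule lower_env_ge[OF U])
      then show False using eq x r by simp
    qed
    then obtain y where y: "y \<in> U" "upper_env X u y < ereal (r + 1)" by blast
    then have "y \<in> T" "y \<in> topspace X" "ereal (r - 1) < u y" by (auto simp: U_def)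
    moreover have "u y \<le> upper_env X u y" using \<open>y \<in> topspace X\<close> by (rule upper_env_ge)
    ultimately have "y \<in> ?D"
      using y by (cases "u y"; cases "upper_env X u y") (auto simp: lower_Interval upper_Interval)
    then have "y \<in> ?D \<inter> T" using \<open>y \<in> T\<close> by (rule IntI)
    then show ?thesis by (metis empty_iff)
  qed
  then have "nearly_finite_interval X ?f"
    by (simp only: nearly_finite_interval_def dense_in_def dense_intersects_open) simp
  then show ?thesis using normal_lsc_imp_hausdorff_continuous[OF u] by (simp add: H_nf_def)
qed

lemma H_nf_eq_imp_NL_eq:
  assumes "as_interval_fun X ` C_space X = H_nf X"
  shows "as_ereal_fun X ` C_space X = NL X"
proof
  show "NL X \<subseteq> as_ereal_fun X ` C_space X"
  proof
    fix u assume u: "u \<in> NL X"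
    have "(\<lambda>x\<in>topspace X. Interval (u x, upper_env X u x)) \<in> as_interval_fun X ` C_space X"
      using NL_imp_H_nf[OF u] by (simp only: assms)
    then obtain g where
      g: "(\<lambda>x\<in>topspace X. Interval (u x, upper_env X u x)) = as_interval_fun X g"
        "g \<in> C_space X"
      by (rule imageE)
    have "u x = as_ereal_fun X g x" if x: "x \<in> topspace X" for x
    proof -
      have "interval_of (ereal (g x)) = Interval (u x, upper_env X u x)"
        using fun_cong[OF g(1), of x] x by (simp add: as_interval_fun_def)
      then have "lower (interval_of (ereal (g x))) = u x"
        using x by (simp add: lower_Interval upper_env_ge)
      then show ?thesis using x by (simp add: as_ereal_fun_def)
    qed
    then have "u = as_ereal_fun X g"
      using u by (intro extensionalityI[of _ "topspace X"]) (auto simp: NL_def as_ereal_fun_def)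
    with g show "u \<in> as_ereal_fun X ` C_space X" by blast
  qed
qed (auto intro: as_ereal_fun_in_NL)

section \<open>Extremally disconnected P-spaces\<close>

text \<open>
  For every \<open>p\<close> the interval function can be refined to lie above \<open>p\<close> on the clopen set
  \<open>closure {f > p}\<close> and below \<open>p\<close> off it, so maximality forces both already to hold.
\<close>

lemma extremally_disconnected_degenerate:
  assumes X: "extremally_disconnected X" and f: "hausdorff_continuous X f"
    and x: "x \<in> topspace X"
  shows "lower (f x) = upper (f x)"
proof (rule ccontr)
  assume "lower (f x) \<noteq> upper (f x)"
  then have "lower (f x) < upper (f x)" by (simp add: less_le)
  then obtain p where p: "lower (f x) < p" "p < upper (f x)" using dense by blast
  have lsc: "lsc X (\<lambda>x. lower (f x))" and usc: "usc X (\<lambda>x. upper (f x))"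
    using f by (auto simp: hausdorff_continuous_def C_interval_iff)
  define P where "P = {x \<in> topspace X. p < lower (f x)}"
  define W where "W = X closure_of P"
  have P: "openin X P" using lsc by (simp add: P_def lsc_def)
  have W: "openin X W" using X P by (simp add: W_def extremally_disconnected_def)
  have cW: "openin X (topspace X - W)"
    unfolding W_def by (intro openin_diff openin_topspace closedin_closure_of)
  have PW: "P \<subseteq> W" unfolding W_def P_def by (rule closure_of_subset) auto
  have WX: "W \<subseteq> topspace X" unfolding W_def by (rule closure_of_subset_topspace)
  \<comment> \<open>If the upper end were below \<open>p\<close> at a point of the closure of
    \<open>P\<close>, it would be so on a neighbourhood, which meets \<open>P\<close>, where already
    the lower end exceeds \<open>p\<close>.\<close>
  have pu: "p \<le> upper (f y)" if "y \<in> W" for y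
  proof (rule ccontr)
    let ?T = "{y \<in> topspace X. upper (f y) < p}"
    assume "\<not> p \<le> upper (f y)"
    then have "y \<in> ?T" "openin X ?T" using that WX usc by (auto simp: usc_def)
    with that obtain z where "z \<in> P" "z \<in> ?T"
      unfolding W_def by (elim closure_of_meetsE)
    then have "p < lower (f z)" "upper (f z) < p" by (simp_all add: P_def)
    then show False by (meson less_le_trans less_asym lower_le_upper)
  qed
  have lp: "lower (f y) \<le> p" if "y \<in> topspace X" "y \<notin> W" for y
    using that PW by (auto simp: P_def)
  let ?l = "\<lambda>y. if y \<in> W then max (lower (f y)) p else lower (f y)"
  let ?u = "\<lambda>y. if y \<in> W then upper (f y) else min (upper (f y)) p"
  have "lsc X ?l"
    unfolding lsc_def
  proof
    fix q
    have "{y \<in> topspace X. q < ?l y} =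
      {y \<in> topspace X. q < lower (f y)} \<union> (if q < p then W else {})"
      using WX by (auto simp: less_max_iff_disj)
    then show "openin X {y \<in> topspace X. q < ?l y}" using lsc W by (auto simp: lsc_def)
  qed
  moreover have "usc X ?u"
    unfolding usc_def
  proof
    fix q
    have "{y \<in> topspace X. ?u y < q} =
      {y \<in> topspace X. upper (f y) < q} \<union> (if p < q then topspace X - W else {})"
      by (auto simp: min_less_iff_disj)
    then show "openin X {y \<in> topspace X. ?u y < q}" using usc cW by (auto simp: usc_def)
  qed
  moreover have "lower (f y) \<le> ?l y \<and> ?l y \<le> ?u y \<and> ?u y \<le> upper (f y)"
    if "y \<in> topspace X" for y
    using pu lp that by auto
  ultimately have "lower (f x) = ?l x" "upper (f x) = ?u x"
    using hausdorff_continuousD[OF f, of ?l ?u] x by blast+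
  \<comment> \<open>If \<open>x\<close> is in \<open>W\<close>, its lower end is at least
    \<open>p\<close>; otherwise its upper end is at most \<open>p\<close>.\<close>
  then show False using p by (auto split: if_splits simp: max_def min_def)
qed

lemma P_space_nearly_finite_imp_finite:
  assumes X: "P_space X" and h: "continuous_map X euclidean h" and fin: "nearly_finite X h"
    and x: "x \<in> topspace X"
  shows "\<bar>h x\<bar> \<noteq> \<infinity>"
proof -
  \<comment> \<open>A continuous real function of an extended real that vanishes exactly at the two
    infinities. The truncation at 1 avoids the pole of the inverse at 0.\<close>
  let ?\<phi> = "\<lambda>t::ereal. real_of_ereal (inverse (max 1 \<bar>t\<bar>))"
  have iff: "?\<phi> t \<noteq> 0 \<longleftrightarrow> \<bar>t\<bar> \<noteq> \<infinity>" for t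
    by (cases t) (auto simp: max_def)
  have "continuous_on UNIV (\<lambda>t::ereal. inverse (max 1 \<bar>t\<bar>))"
    by (rule continuous_on_compose2[OF continuous_on_inverse_ereal])
      (auto intro!: continuous_intros continuous_ereal_abs simp: le_max_iff_disj)
  moreover have "max 1 \<bar>t\<bar> \<noteq> 0" for t :: ereal
    by (auto simp: max_def)
  ultimately have "continuous_on UNIV ?\<phi>"
    by (intro continuous_on_compose2[OF continuous_on_real]) auto
  then have "continuous_map X euclideanreal (?\<phi> \<circ> h)"
    by (intro continuous_map_compose[OF h]) simp
  then have "restrict (?\<phi> \<circ> h) (topspace X) \<in> C_space X" by (rule restrict_C_space)
  then have "closedin X {x \<in> topspace X. restrict (?\<phi> \<circ> h) (topspace X) x \<noteq> 0}"
    by (rule bspec[OF X[unfolded P_space_def]])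
  moreover have "{x \<in> topspace X. restrict (?\<phi> \<circ> h) (topspace X) x \<noteq> 0} =
      {x \<in> topspace X. \<bar>h x\<bar> \<noteq> \<infinity>}"
    using iff by auto
  ultimately have "X closure_of {x \<in> topspace X. \<bar>h x\<bar> \<noteq> \<infinity>} = {x \<in> topspace X. \<bar>h x\<bar> \<noteq> \<infinity>}"
    by (simp add: closure_of_closedin)
  then have "{x \<in> topspace X. \<bar>h x\<bar> \<noteq> \<infinity>} = topspace X"
    using fin by (simp only: nearly_finite_def dense_in_def)
  with x have "x \<in> {x \<in> topspace X. \<bar>h x\<bar> \<noteq> \<infinity>}" by (simp only:)
  then show ?thesis by simp
qed

lemma H_nf_eq_if_extremally_disconnected_P_space:
  assumes X: "extremally_disconnected X" "P_space X"
  shows "as_interval_fun X ` C_space X = H_nf X"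
proof
  show "H_nf X \<subseteq> as_interval_fun X ` C_space X"
  proof
    fix f assume f: "f \<in> H_nf X"
    then have hc: "hausdorff_continuous X f" by (simp add: H_nf_def)
    then have C: "f \<in> C_interval X" by (simp add: hausdorff_continuous_def)
    note eq = extremally_disconnected_degenerate[OF X(1) hc]
    define h where "h = (\<lambda>x. lower (f x))"
    have "usc X h" "lsc X h"
      using C eq by (auto simp: C_interval_iff h_def cong: usc_cong)
    then have h: "continuous_map X euclidean h"
      by (simp add: continuous_map_upper_lower_semicontinuous_lt lsc_def usc_def)
    have "nearly_finite X h"
      using f eq unfolding H_nf_def nearly_finite_interval_def nearly_finite_def h_def
      by (simp cong: conj_cong)
    note fin = P_space_nearly_finite_imp_finite[OF X(2) h this]
    define g where "g = restrict (real_of_ereal \<circ> h) (topspace X)"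
    \<comment> \<open>\<open>real_of_ereal\<close> sends the infinities to 0 and is continuous only
      away from them, so \<open>h\<close> is first corestricted to the finite values.\<close>
    have "continuous_map X (top_of_set (UNIV - {\<infinity>, -\<infinity>})) h"
      using h by (auto simp: continuous_map_in_subtopology dest: fin)
    then have "continuous_map X euclideanreal (real_of_ereal \<circ> h)"
      by (rule continuous_map_compose) (simp add: continuous_on_real)
    then have g: "g \<in> C_space X" unfolding g_def by (rule restrict_C_space)
    have "f x = as_interval_fun X g x" if "x \<in> topspace X" for x
      using that fin[OF that] eq[OF that]
      by (auto simp: interval_eq_iff as_interval_fun_def g_def h_def ereal_real')
    then have "f = as_interval_fun X g"
      using C by (intro extensionalityI[of _ "topspace X"])
        (auto simp: C_interval_def as_interval_fun_def)
    with g show "f \<in> as_interval_fun X ` C_space X" by blast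
  qed
qed (auto intro: as_interval_fun_in_H_nf)

section \<open>Universal completeness\<close>

text \<open>The pointwise supremum h is lower semicontinuous, so I(S h) lies above it and hence
  above A. A continuous upper bound k is its own I(S k), hence lies above I(S h) by monotonicity.
  The hypothesis on \<open>NL\<close> makes I(S h) a real continuous function.\<close>

lemma NL_eq_imp_supremum:
  assumes NL: "as_ereal_fun X ` C_space X = NL X" and A: "A \<subseteq> C_space X"
    and fin: "nearly_finite X (lower_env X (upper_env X (\<lambda>x. SUP a\<in>A. ereal (a x))))"
  shows "\<exists>s. is_supremum (C_riesz X) A s"
proof -
  define h where "h = (\<lambda>x. SUP a\<in>A. ereal (a x))"
  define v where "v = lower_env X (upper_env X h)"
  have "restrict v (topspace X) \<in> NL X"
    using fin normal_lsc_lower_upper_env[of X h]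
    by (simp add: NL_def v_def h_def nearly_finite_def cong: normal_lsc_cong conj_cong)
  then obtain g where g: "g \<in> C_space X" "as_ereal_fun X g = restrict v (topspace X)"
    using NL by (metis imageE)
  have gv: "ereal (g x) = v x" if "x \<in> topspace X" for x
    using fun_cong[OF g(2), of x] that by (simp add: as_ereal_fun_def)
  have lsc: "lsc X h"
    unfolding lsc_def
  proof
    fix p
    have "{x \<in> topspace X. p < h x} = (\<Union>a\<in>A. {x \<in> topspace X. p < ereal (a x)})"
      by (auto simp: h_def less_SUP_iff)
    then show "openin X {x \<in> topspace X. p < h x}"
      using A by (auto intro!: openin_C_space(1))
  qed
  have "a x \<le> g x" if "a \<in> A" "x \<in> topspace X" for a x
  proof -
    have "ereal (a x) \<le> h x" using that by (auto simp: h_def intro: SUP_upper)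
    also have "\<dots> \<le> v x"
      unfolding v_def using lsc that by (intro lsc_le_lower_env upper_env_ge)
    finally show ?thesis using gv[OF that(2)] by (metis ereal_less_eq(3))
  qed
  moreover have "g x \<le> k x"
    if k: "k \<in> C_space X" "\<And>a x. a \<in> A \<Longrightarrow> x \<in> topspace X \<Longrightarrow> a x \<le> k x" and x: "x \<in> topspace X" for k x
  proof -
    let ?k = "as_ereal_fun X k"
    have "h y \<le> ?k y" if "y \<in> topspace X" for y
      using k that by (auto simp: h_def as_ereal_fun_def intro: SUP_least)
    then have "v x \<le> lower_env X (upper_env X ?k) x"
      unfolding v_def by (intro lower_env_mono upper_env_mono)
    also have "\<dots> = ?k x"
      using as_ereal_fun_in_NL[OF k(1)] x by (simp add: NL_def normal_lsc_def)
    finally have "ereal (g x) \<le> ereal (k x)" using gv[OF x] x by (simp add: as_ereal_fun_def)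
    then show ?thesis by simp
  qed
  ultimately have "is_supremum (C_riesz X) A g"
    using g(1) by (auto simp: is_supremum_def is_upper_bound_def C_riesz_def)
  then show ?thesis by blast
qed

text \<open>The pointwise minimum is a lower bound in C(X), which turns order-theoretic disjointness
  into a pointwise statement.\<close>

lemma infimum_zero_imp_le_zero:
  assumes "is_infimum (C_riesz X) {u, v} (rzero (C_riesz X))" "u \<in> C_space X" "v \<in> C_space X"
    and "x \<in> topspace X"
  shows "min (u x) (v x) \<le> 0"
proof -
  let ?m = "\<lambda>x\<in>topspace X. min (u x) (v x)"
  have "?m \<in> C_space X"
    using assms by (intro restrict_C_space continuous_map_real_min C_space_cont)
  then have "is_lower_bound (C_riesz X) {u, v} ?m"
    by (auto simp: is_lower_bound_def C_riesz_def)
  then have "rle (C_riesz X) ?m (rzero (C_riesz X))"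
    using assms by (auto simp: is_infimum_def)
  then show ?thesis using assms(4) by (auto simp: C_riesz_def)
qed

lemma NL_eq_imp_universally_complete:
  assumes NL: "as_ereal_fun X ` C_space X = NL X"
  shows "universally_complete (C_riesz X)"
proof -
  \<comment> \<open>Finiteness is local: a constant bound for \<open>A\<close> on an open set bounds
    the envelope from above there, and any single member of \<open>A\<close> bounds it from
    below.\<close>
  have fin: "\<bar>lower_env X (upper_env X (\<lambda>x. SUP a\<in>A. ereal (a x))) x\<bar> \<noteq> \<infinity>"
    if A: "A \<subseteq> C_space X" "A \<noteq> {}" and U: "openin X U" "x \<in> U"
      and bd: "\<And>y a. y \<in> U \<Longrightarrow> a \<in> A \<Longrightarrow> a y \<le> c" for A U x c
  proof -
    let ?h = "\<lambda>x. SUP a\<in>A. ereal (a x)"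
    have x: "x \<in> topspace X" using U openin_subset by blast
    obtain a where a: "a \<in> A" using A by blast
    let ?a = "as_ereal_fun X a"
    have "ereal (a x) = lower_env X (upper_env X ?a) x"
      using as_ereal_fun_in_NL[of a X] a A x by (auto simp: NL_def normal_lsc_def as_ereal_fun_def)
    also have "\<dots> \<le> lower_env X (upper_env X ?h) x"
      using a by (intro lower_env_mono upper_env_mono) (auto simp: as_ereal_fun_def intro: SUP_upper)
    finally have 1: "ereal (a x) \<le> lower_env X (upper_env X ?h) x" .
    have "lower_env X (upper_env X ?h) x \<le> upper_env X ?h x" using x by (rule lower_env_le)
    also have "\<dots> \<le> ereal c"
      using U bd by (intro upper_env_le[of X U]) (auto intro: SUP_least)
    finally show ?thesis using 1 by auto
  qed
  have "\<exists>s. is_supremum (C_riesz X) A s"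
    if A: "A \<subseteq> C_space X" "A \<noteq> {}" and k: "is_upper_bound (C_riesz X) A k" for A k
  proof (rule NL_eq_imp_supremum[OF NL A(1)])
    have kC: "k \<in> C_space X" and le: "\<And>a x. a \<in> A \<Longrightarrow> x \<in> topspace X \<Longrightarrow> a x \<le> k x"
      using k by (auto simp: is_upper_bound_def C_riesz_def)
    have "\<bar>lower_env X (upper_env X (\<lambda>x. SUP a\<in>A. ereal (a x))) x\<bar> \<noteq> \<infinity>"
      if x: "x \<in> topspace X" for x
      \<comment> \<open>Near \<open>x\<close> the upper bound \<open>k\<close> stays below the
        constant \<open>k x + 1\<close>, as \<open>fin\<close> requires.\<close>
      using le x openin_C_space(2)[OF kC, of "ereal (k x + 1)"]
      by (intro fin[OF A, of "{y \<in> topspace X. ereal (k y) < ereal (k x + 1)}" _ "k x + 1"])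
        force+
    then show "nearly_finite X (lower_env X (upper_env X (\<lambda>x. SUP a\<in>A. ereal (a x))))"
      by (simp add: nearly_finite_def dense_in_def cong: conj_cong)
  qed
  moreover have "\<exists>s. is_supremum (C_riesz X) A s"
    if A: "A \<subseteq> C_space X" "A \<noteq> {}"
      and pos: "\<And>u. u \<in> A \<Longrightarrow> rle (C_riesz X) (rzero (C_riesz X)) u"
      and disj: "pairwise (\<lambda>u v. is_infimum (C_riesz X) {u, v} (rzero (C_riesz X))) A" for A
  proof (rule NL_eq_imp_supremum[OF NL A(1)])
    let ?v = "lower_env X (upper_env X (\<lambda>x. SUP a\<in>A. ereal (a x)))"
    have "{x \<in> topspace X. \<bar>?v x\<bar> \<noteq> \<infinity>} \<inter> T \<noteq> {}" if T: "openin X T" "T \<noteq> {}" for T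
    \<comment> \<open>If some \<open>a\<close> is positive at a point of \<open>T\<close>,
      disjointness makes all other members nonpositive near it, so only \<open>a\<close> has to be
      bounded. Otherwise 0 bounds \<open>A\<close> on \<open>T\<close>.\<close>
    proof (cases "\<exists>a\<in>A. \<exists>x\<in>T. 0 < a x")
      case True
      then obtain a x where a: "a \<in> A" "x \<in> T" "0 < a x" by blast
      have aC: "a \<in> C_space X" using a A by blast
      let ?U = "{y \<in> topspace X. 0 < ereal (a y)} \<inter> {y \<in> topspace X. ereal (a y) < ereal (a x + 1)}"
      have x: "x \<in> topspace X" using a T openin_subset by blast
      have bd: "b y \<le> a x + 1" if y: "y \<in> ?U" and b: "b \<in> A" for y b
      proof (cases "b = a")
        case False
        then have "min (b y) (a y) \<le> 0"
          using disj b a A y by (intro infimum_zero_imp_le_zero[of X]) (auto dest: pairwiseD)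
        then show ?thesis using y a by auto
      qed (use y in auto)
      have "openin X ?U" by (intro openin_Int openin_C_space[OF aC])
      moreover have "x \<in> ?U" using a x by simp
      ultimately have "\<bar>?v x\<bar> \<noteq> \<infinity>" using bd by (rule fin[OF A])
      then have "x \<in> {x \<in> topspace X. \<bar>?v x\<bar> \<noteq> \<infinity>} \<inter> T" using a x by simp
      then show ?thesis by (metis empty_iff)
    next
      case False
      obtain x where x: "x \<in> T" using T by blast
      then have "x \<in> topspace X" using T openin_subset by blast
      moreover have "\<bar>?v x\<bar> \<noteq> \<infinity>"
        using False T x by (intro fin[OF A, of T _ 0]) (auto simp: not_less)
      ultimately have "x \<in> {x \<in> topspace X. \<bar>?v x\<bar> \<noteq> \<infinity>} \<inter> T" using x by simp
      then show ?thesis by (metis empty_iff)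
    qed
    then show "nearly_finite X ?v"
      by (simp add: nearly_finite_def dense_in_def dense_intersects_open)
  qed
  ultimately show ?thesis
    using riesz_space_C_riesz[of X]
    unfolding universally_complete_def dedekind_complete_def laterally_complete_def
    by (simp add: C_riesz_def) blast
qed

section \<open>From completeness of C(X) back to the topology of X\<close>

lemma restrict_indicator_clopen_in_C_space:
  fixes c :: real
  assumes "openin X W" "closedin X W"
  shows "(\<lambda>x\<in>topspace X. if x \<in> W then c else 0) \<in> C_space X"
proof (rule restrict_C_space)
  have "{x \<in> topspace X. (if x \<in> W then c else 0) \<in> U} =
      (if c \<in> U then W else {}) \<union> (if 0 \<in> U then topspace X - W else {})" for U
    using openin_subset[OF assms(1)] by auto
  then show "continuous_map X euclideanreal (\<lambda>x. if x \<in> W then c else 0)"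
    using assms by (auto simp: continuous_map_def closedin_def)
qed

lemma dedekind_complete_imp_extremally_disconnected:
  assumes X: "completely_regular_space X" and D: "dedekind_complete (C_riesz X)"
  shows "extremally_disconnected X"
  unfolding extremally_disconnected_def
proof (intro allI impI)
  fix U assume U: "openin X U"
  have UX: "U \<subseteq> topspace X" using U by (rule openin_subset)
  have sep: "\<exists>f. f \<in> C_space X \<and> (\<forall>y\<in>topspace X. 0 \<le> f y \<and> f y \<le> 1) \<and> f x = 0 \<and> (\<forall>y\<in>S. f y = 1)"
    if S: "closedin X S" and x: "x \<in> topspace X - S" for S x
  proof -
    obtain f where f: "continuous_map X (top_of_set {0..1}) f" "f x = (0::real)" "f ` S \<subseteq> {1}"
      using X S x unfolding completely_regular_space_def by blast
    then have "continuous_map X euclideanreal f" "f ` topspace X \<subseteq> {0..1}"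
      by (auto simp: continuous_map_in_subtopology)
    then show ?thesis
      using f x closedin_subset[OF S]
      by (intro exI[of _ "restrict f (topspace X)"] conjI restrict_C_space) auto
  qed
  define A where "A = {f \<in> C_space X. \<forall>x\<in>topspace X. 0 \<le> f x \<and> f x \<le> (if x \<in> U then 1 else 0)}"
  have zero: "(\<lambda>x\<in>topspace X. 0) \<in> A" by (auto simp: A_def restrict_C_space)
  have one: "(\<lambda>x\<in>topspace X. 1) \<in> C_space X" by (simp add: restrict_C_space)
  then have ub1: "is_upper_bound (C_riesz X) A (\<lambda>x\<in>topspace X. 1)"
    by (fastforce simp: is_upper_bound_def C_riesz_def A_def split: if_splits)
  obtain s where s: "is_supremum (C_riesz X) A s"
    using D ub1 zero unfolding dedekind_complete_def
    by (metis (no_types, lifting) A_def C_riesz_def empty_iff mem_Collect_eq riesz.select_convs(1) subsetI)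
  have sC: "s \<in> C_space X" and sA: "\<And>a x. a \<in> A \<Longrightarrow> x \<in> topspace X \<Longrightarrow> a x \<le> s x"
    and s_least: "\<And>k x. k \<in> C_space X \<Longrightarrow> (\<And>a x. a \<in> A \<Longrightarrow> x \<in> topspace X \<Longrightarrow> a x \<le> k x)
        \<Longrightarrow> x \<in> topspace X \<Longrightarrow> s x \<le> k x"
    using s by (auto simp: is_supremum_def is_upper_bound_def C_riesz_def)
  \<comment> \<open>Complete regularity gives a member of \<open>A\<close> with value 1 at
    \<open>x\<close>, namely \<open>1 - f\<close> for \<open>f\<close> separating \<open>x\<close>
    from the complement of \<open>U\<close>.\<close>
  have "1 \<le> s x" if x: "x \<in> U" for x
  proof -
    have "closedin X (topspace X - U)" "x \<in> topspace X - (topspace X - U)"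
      using U UX x by auto
    from sep[OF this] obtain f where f: "f \<in> C_space X"
      "\<forall>y\<in>topspace X. 0 \<le> f y \<and> f y \<le> 1" "f x = 0" "\<forall>y\<in>topspace X - U. f y = 1"
      by (elim exE conjE)
    let ?g = "\<lambda>y\<in>topspace X. 1 - f y"
    have "continuous_map X euclideanreal (\<lambda>y. 1 - f y)"
      using C_space_cont[OF f(1)] by (intro continuous_map_diff) auto
    then have "?g \<in> C_space X" by (rule restrict_C_space)
    then have "?g \<in> A" using f by (auto simp: A_def)
    from sA[OF this, of x] show ?thesis using x UX f(3) by auto
  qed
  then have "U \<subseteq> {x \<in> topspace X. 1 \<le> s x}" using UX by auto
  moreover have "closedin X {x \<in> topspace X. 1 \<le> s x}"
    using C_space_cont[OF sC] by (simp add: continuous_map_upper_lower_semicontinuous_le)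
  ultimately have 1: "X closure_of U \<subseteq> {x \<in> topspace X. 1 \<le> s x}" by (rule closure_of_minimal)
  \<comment> \<open>A function equal to 1 on the closure of \<open>U\<close> and 0 at
    \<open>x\<close> is an upper bound of \<open>A\<close>, so the least one is at most 0 at
    \<open>x\<close>.\<close>
  have 2: "s x \<le> 0" if x: "x \<in> topspace X" "x \<notin> X closure_of U" for x
  proof -
    have "x \<in> topspace X - X closure_of U" using x by simp
    from sep[OF closedin_closure_of this] obtain k where k: "k \<in> C_space X"
      "\<forall>y\<in>topspace X. 0 \<le> k y \<and> k y \<le> 1" "k x = 0" "\<forall>y\<in>X closure_of U. k y = 1"
      by (elim exE conjE)
    have "a y \<le> k y" if "a \<in> A" "y \<in> topspace X" for a y
      using that k(2,4) closure_of_subset[OF UX] by (force simp: A_def split: if_splits)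
    then have "s x \<le> k x" by (intro s_least k x)
    then show ?thesis using k by simp
  qed
  \<comment> \<open>Since \<open>s\<close> jumps from at most 0 to at least 1, the closure is also
    given by a strict inequality, which is an open condition.\<close>
  have "X closure_of U = {x \<in> topspace X. 0 < ereal (s x)}"
    using 1 2 closure_of_subset_topspace[of X U] by (force simp: not_less)
  then show "openin X (X closure_of U)" using openin_C_space(1)[OF sC, of 0] by simp
qed

text \<open>
  The cozero set of \<open>f\<close> is the disjoint union of the clopen sets \<open>V n - V (n - 1)\<close>, where
  \<open>V n\<close> is the closure of \<open>{\<bar>f\<bar> > 1/(n + 1)}\<close>.  An upper bound of the functions equal to \<open>n\<close>
  on the \<open>n\<close>-th of them would be unbounded near any zero of \<open>f\<close> in the closure of the cozero set.
\<close>

lemma laterally_complete_imp_P_space: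
  assumes X: "extremally_disconnected X" and L: "laterally_complete (C_riesz X)"
  shows "P_space X"
  unfolding P_space_def
proof
  fix f assume f: "f \<in> C_space X"
  define V where "V n = X closure_of {x \<in> topspace X. inverse (real (Suc n)) < \<bar>f x\<bar>}" for n
  define W where "W n = V n - (\<Union>m<n. V m)" for n
  define a where "a n = (\<lambda>x\<in>topspace X. if x \<in> W n then real n else 0)" for n
  have cont: "continuous_map X euclideanreal (\<lambda>x. \<bar>f x\<bar>)"
    using C_space_cont[OF f] by (rule continuous_map_real_abs)
  have V: "openin X (V n)" "closedin X (V n)" for n
    using X cont unfolding V_def extremally_disconnected_def
    by (auto simp: continuous_map_upper_lower_semicontinuous_lt)
  have W: "openin X (W n)" "closedin X (W n)" for n
    unfolding W_def using V by (auto intro!: openin_diff closedin_diff closedin_Union openin_Union)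
  have aC: "a n \<in> C_space X" for n
    unfolding a_def using W by (rule restrict_indicator_clopen_in_C_space)
  have disj: "m = n" if "x \<in> W m" "x \<in> W n" for m n x
  proof (rule linorder_cases)
    show "m = n" if "m < n" using that \<open>x \<in> W m\<close> \<open>x \<in> W n\<close> by (auto simp: W_def)
    show "m = n" if "n < m" using that \<open>x \<in> W m\<close> \<open>x \<in> W n\<close> by (auto simp: W_def)
  qed
  have "is_infimum (C_riesz X) {a m, a n} (rzero (C_riesz X))" if "m \<noteq> n" for m n
  proof -
    \<comment> \<open>The sets \<open>W n\<close> are disjoint, so at each point at least one of the
      two functions is 0.\<close>
    have "w x \<le> 0" if "w x \<le> a m x" "w x \<le> a n x" "x \<in> topspace X" for w x
      using that disj[of x m n] \<open>m \<noteq> n\<close> by (auto simp: a_def split: if_splits)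
    then show ?thesis
      by (auto simp: is_infimum_def is_lower_bound_def C_riesz_def restrict_C_space a_def)
  qed
  then have "pairwise (\<lambda>u v. is_infimum (C_riesz X) {u, v} (rzero (C_riesz X))) (range a)"
    by (auto intro!: pairwise_imageI)
  moreover have "range a \<subseteq> rcarrier (C_riesz X)" using aC by (auto simp: C_riesz_def)
  moreover have "rle (C_riesz X) (rzero (C_riesz X)) u" if "u \<in> range a" for u
    using that by (auto simp: C_riesz_def a_def)
  ultimately obtain s where s: "is_supremum (C_riesz X) (range a) s"
    using L unfolding laterally_complete_def by (metis UNIV_not_empty image_is_empty)
  then have sC: "s \<in> C_space X" and as: "\<And>n x. x \<in> topspace X \<Longrightarrow> a n x \<le> s x"
    by (auto simp: is_supremum_def is_upper_bound_def C_riesz_def)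
  let ?Z = "{x \<in> topspace X. f x \<noteq> 0}"
  have "x \<in> ?Z" if x: "x \<in> X closure_of ?Z" for x
  proof (rule ccontr)
    assume "x \<notin> ?Z"
    moreover have xX: "x \<in> topspace X" using x by (simp add: in_closure_of)
    ultimately have fx: "f x = 0" by simp
    obtain N where N: "s x + 1 < real N" using reals_Archimedean2 by blast
    \<comment> \<open>On \<open>?T\<close> the bound \<open>s\<close> stays below \<open>N\<close>,
      while the smallness of \<open>f\<close> forces any point there into a \<open>W n\<close> with
      \<open>n\<close> at least \<open>N\<close>, where \<open>s\<close> is at least
      \<open>n\<close>.\<close>
    let ?T = "{y \<in> topspace X. ereal (s y) < ereal (s x + 1)} \<inter>
        {y \<in> topspace X. \<bar>f y\<bar> < inverse (real (Suc N))}"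
    have "openin X ?T"
      using cont by (intro openin_Int openin_C_space[OF sC])
        (auto simp: continuous_map_upper_lower_semicontinuous_lt)
    moreover have "x \<in> ?T" using xX fx by simp
    ultimately obtain z where z: "z \<in> ?Z" "z \<in> ?T" by (rule closure_of_meetsE[OF x])
    have "\<exists>n. z \<in> V n"
    proof -
      obtain n where "inverse (real (Suc n)) < \<bar>f z\<bar>" using z reals_Archimedean[of "\<bar>f z\<bar>"] by auto
      then have "z \<in> V n" using z unfolding V_def by (intro subsetD[OF closure_of_subset]) auto
      then show ?thesis ..
    qed
    \<comment> \<open>The first index with \<open>z\<close> in \<open>V n\<close> is the one with
      \<open>z\<close> in \<open>W n\<close>.\<close>
    define n where "n = (LEAST n. z \<in> V n)"
    have zV: "z \<in> V n" unfolding n_def using \<open>\<exists>n. z \<in> V n\<close> by (rule LeastI_ex)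
    moreover have "z \<notin> V m" if "m < n" for m using that not_less_Least unfolding n_def by blast
    ultimately have "z \<in> W n" by (auto simp: W_def)
    \<comment> \<open>Passing to the closure keeps only the weak inequality; the strict one in
      \<open>?T\<close> makes up for it.\<close>
    have "V n \<subseteq> {y \<in> topspace X. inverse (real (Suc n)) \<le> \<bar>f y\<bar>}"
      unfolding V_def using cont
      by (intro closure_of_minimal) (auto simp: continuous_map_upper_lower_semicontinuous_le)
    from subsetD[OF this zV] have "inverse (real (Suc n)) \<le> \<bar>f z\<bar>" by simp
    also have "\<dots> < inverse (real (Suc N))" using z(2) by simp
    finally have "inverse (real (Suc n)) < inverse (real (Suc N))" .
    then have "N \<le> n" by (simp add: field_simps)
    moreover have "real n \<le> s z" using as[of z n] \<open>z \<in> W n\<close> z by (simp add: a_def)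
    ultimately show False using z N by auto
  qed
  then have "X closure_of ?Z \<subseteq> ?Z" by (rule subsetI)
  moreover have "?Z \<subseteq> X closure_of ?Z" by (rule closure_of_subset) simp
  ultimately have "X closure_of ?Z = ?Z" by (rule equalityI)
  with closedin_closure_of[of X ?Z] show "closedin X ?Z" by (simp only:)
qed

theorem corollary6p6:
  fixes X :: "'a topology"
  assumes "completely_regular_space X"
  shows "((extremally_disconnected X \<and> P_space X) \<longleftrightarrow> as_interval_fun X ` C_space X = H_nf X)
    \<and> ((extremally_disconnected X \<and> P_space X) \<longleftrightarrow> as_ereal_fun X ` C_space X = NL X)
    \<and> ((extremally_disconnected X \<and> P_space X) \<longleftrightarrow> universally_complete (C_riesz X))"
proof -
  let ?ED = "extremally_disconnected X" and ?P = "P_space X"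
  let ?H = "as_interval_fun X ` C_space X = H_nf X"
  let ?N = "as_ereal_fun X ` C_space X = NL X"
  let ?U = "universally_complete (C_riesz X)"
  have "?ED \<and> ?P \<longrightarrow> ?H" by (intro impI H_nf_eq_if_extremally_disconnected_P_space) simp_all
  moreover have "?H \<longrightarrow> ?N" by (intro impI H_nf_eq_imp_NL_eq)
  moreover have "?N \<longrightarrow> ?U" by (intro impI NL_eq_imp_universally_complete)
  moreover have "?U \<longrightarrow> ?ED"
    by (simp add: universally_complete_def dedekind_complete_imp_extremally_disconnected[OF assms])
  \<comment> \<open>Extremal disconnectedness comes first: it makes the closures in the P-space
    argument clopen.\<close>
  moreover have "?U \<longrightarrow> ?ED \<longrightarrow> ?P"
    by (simp add: universally_complete_def laterally_complete_imp_P_space)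
  ultimately show ?thesis by satx
qed

end
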